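(* Let $X$ be a nonzero real Banach space. (i) If $\mathrm{mr}(X)>1$ then $X$ is uniformly smooth. (ii) If $\mathrm{mc}(X)<\infty$ then $X$ is uniformly convex.
   Context: A metric space $(X,d)$ has roundness $p\geq 1$ if for all $a_1,a_2,b_1,b_2\in X$, $d(a_1,a_2)^p+d(b_1,b_2)^p\leq\sum_{1\leq i,j\leq 2}d(a_i,b_j)^p$. For a Banach space this is equivalent (Enflo) to $\|x+y\|^p+\|x-y\|^p\leq 2(\|x\|^p+\|y\|^p)$ for all $x,y\in X$. Put $\mathrm{mr}(X)=\sup\{p\geq 1: X\text{ has roundness }p\}$. For $p\ge1$ let $\nu_X(p)=\sup\left\{\frac{\|x+y\|^p+\|x-y\|^p}{\|x\|^p+\|y\|^p}: x,y\in X\text{ not both zero}\right\}$. For $2\le p<\infty$, $X$ has coroundness $p$ if $\|x+y\|^p+\|x-y\|^p\leq 2^{p-1}(\|x\|^p+\|y\|^p)$ for all $x,y\in X$ (equivalently $\nu_X(p)=2^{p-1}$). Put $\mathrm{mc}(X)=\inf\{p:\nu_X(p)=2^{p-1}\}$, with $\mathrm{mc}(X)=\infty$ if this set is empty. $X$ is uniformly smooth if for all $\epsilon>0$ there is $\delta>0$ such that $\|x\|=1$ and $\|y\|\leq\delta$ imply $\|x+y\|+\|x-y\|\leq 2+\epsilon\|y\|$. $X$ is uniformly convex if for all $\epsilon>0$ there is $\delta>0$ such that for $x,y\in X$ with $\|x\|=\|y\|=1$ and $\|x-y\|\geq\epsilon$ one has $\left\|\frac{x+y}{2}\right\|\leq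 1-\delta$. *)

theory Defs
  imports "HOL-Analysis.Analysis"
begin

text \<open>
  The space is represented by its type, passed as \<open>TYPE('a)\<close>. Suprema and infima are taken in
  \<^typ>\<open>ereal\<close>, so that they always exist; in particular \<open>Inf {} = \<infinity>\<close>, as required for \<open>max_coround\<close>.
\<close>

definition has_roundness :: "'a::metric_space itself \<Rightarrow> real \<Rightarrow> bool" where
  "has_roundness _ p \<longleftrightarrow>
     (\<forall>a1 a2 b1 b2 :: 'a.
        dist a1 a2 powr p + dist b1 b2 powr p
          \<le> dist a1 b1 powr p + dist a1 b2 powr p + dist a2 b1 powr p + dist a2 b2 powr p)"

definition max_round :: "'a::metric_space itself \<Rightarrow> ereal" where
  "max_round X = Sup {ereal p | p. p \<ge> 1 \<and> has_roundness X p}"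

definition nu :: "'a::real_normed_vector itself \<Rightarrow> real \<Rightarrow> ereal" where
  "nu _ p =
     Sup {ereal ((norm (x + y) powr p + norm (x - y) powr p) / (norm x powr p + norm y powr p))
          | x y :: 'a. \<not> (x = 0 \<and> y = 0)}"

text \<open>
  Coroundness is considered for exponents \<open>p \<ge> 2\<close> only, while \<open>nu\<close> is defined for \<open>p \<ge> 1\<close>.
  In a nonzero space both ranges give the same infimum: \<open>y = 0\<close> shows \<open>nu X p \<ge> 2\<close>, so that
  \<open>nu X p = 2 powr (p - 1)\<close> forces \<open>p \<ge> 2\<close>.
\<close>

definition max_coround :: "'a::real_normed_vector itself \<Rightarrow> ereal" where
  "max_coround X = Inf {ereal p | p. p \<ge> 1 \<and> nu X p = ereal (2 powr (p - 1))}"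

definition uniformly_smooth :: "'a::real_normed_vector itself \<Rightarrow> bool" where
  "uniformly_smooth _ \<longleftrightarrow>
     (\<forall>\<epsilon>>0. \<exists>\<delta>>0. \<forall>x y :: 'a.
        norm x = 1 \<longrightarrow> norm y \<le> \<delta> \<longrightarrow> norm (x + y) + norm (x - y) \<le> 2 + \<epsilon> * norm y)"

definition uniformly_convex :: "'a::real_normed_vector itself \<Rightarrow> bool" where
  "uniformly_convex _ \<longleftrightarrow>
     (\<forall>\<epsilon>>0. \<exists>\<delta>>0. \<forall>x y :: 'a.
        norm x = 1 \<longrightarrow> norm y = 1 \<longrightarrow> norm (x - y) \<ge> \<epsilon> \<longrightarrow> norm ((x + y) /\<^sub>R 2) \<le> 1 - \<delta>)"

end

theory Submission
  imports Defs
begin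

text \<open>
  Both parts rest on Bernoulli's inequality \<open>1 + p * (t - 1) \<le> t powr p\<close>, which says that the
  graph of the \<open>p\<close>-th power lies above its tangent at \<open>1\<close>. It turns an inequality between
  \<open>p\<close>-th powers of norms, where all norms are compared with \<open>1\<close>, into a linear one.

  For smoothness, roundness of the parallelogram with diagonals \<open>{0, x + y}\<close> and \<open>{x, y}\<close> gives
  \<open>\<parallel>x + y\<parallel>\<^sup>p + \<parallel>x - y\<parallel>\<^sup>p \<le> 2 (\<parallel>x\<parallel>\<^sup>p + \<parallel>y\<parallel>\<^sup>p)\<close>. For \<open>\<parallel>x\<parallel> = 1\<close>, linearising the left-hand side
  leaves \<open>\<parallel>x + y\<parallel> + \<parallel>x - y\<parallel> - 2 \<le> (2 / p) \<parallel>y\<parallel>\<^sup>p\<close>, and the right-hand side is \<open>o(\<parallel>y\<parallel>)\<close>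
  precisely because \<open>p > 1\<close>.

  For convexity, coroundness for unit vectors \<open>x, y\<close> reads
  \<open>\<parallel>(x + y) / 2\<parallel>\<^sup>p + \<parallel>(x - y) / 2\<parallel>\<^sup>p \<le> 1\<close>, and linearising the first term gives
  \<open>\<parallel>(x + y) / 2\<parallel> \<le> 1 - \<parallel>(x - y) / 2\<parallel>\<^sup>p / p\<close>.
\<close>

text \<open>
  Convexity is used on the open half-line only, where \<open>1\<close> is an interior point and the power
  function is differentiable; at \<open>t = 0\<close>, where \<open>0 powr p = 0\<close>, the claim is just \<open>p \<ge> 1\<close>.
\<close>

lemma powr_above_tangent_at_1:
  fixes t p :: real
  assumes "t \<ge> 0" "p \<ge> 1"
  shows "1 + p * (t - 1) \<le> t powr p"
proof (cases "t = 0")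
  case True
  with assms show ?thesis by simp
next
  case False
  have "p * (t - 1) \<le> t powr p - 1 powr p"
  proof (rule convex_on_imp_above_tangent)
    show "convex_on {0<..} (\<lambda>t. t powr p)"
      using assms by (intro powr_convex)
    show "((\<lambda>t. t powr p) has_field_derivative p) (at 1 within {0<..})"
      by (auto intro!: derivative_eq_intros)
  qed (use assms False in \<open>auto simp: interior_open\<close>)
  then show ?thesis by simp
qed

lemma has_roundness_parallelogram:
  fixes x y :: "'a::real_normed_vector"
  assumes "has_roundness TYPE('a) p"
  shows "norm (x + y) powr p + norm (x - y) powr p \<le> 2 * (norm x powr p + norm y powr p)"
proof -
  have "dist (x + y) 0 powr p + dist x y powr p
      \<le> dist (x + y) x powr p + dist (x + y) y powr p + dist 0 x powr p + dist 0 y powr p"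
    using assms unfolding has_roundness_def by blast
  then show ?thesis by (simp add: dist_norm)
qed

lemma has_roundness_imp_uniformly_smooth:
  assumes round: "has_roundness TYPE('a::real_normed_vector) p" and p: "p > 1"
  shows "uniformly_smooth TYPE('a)"
  unfolding uniformly_smooth_def
proof (intro allI impI)
  fix \<epsilon> :: real
  assume \<epsilon>: "\<epsilon> > 0"
  \<comment> \<open>the solution of \<open>2 * \<delta> powr (p - 1) = \<epsilon>\<close>\<close>
  define \<delta> where "\<delta> = (\<epsilon> / 2) powr (1 / (p - 1))"
  have \<delta>_powr: "\<delta> powr (p - 1) = \<epsilon> / 2"
    using \<epsilon> p by (simp add: \<delta>_def powr_powr)
  have "norm (x + y) + norm (x - y) \<le> 2 + \<epsilon> * norm y"
    if x: "norm x = 1" and y: "norm y \<le> \<delta>" for x y :: 'a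
  proof -
    have "norm y powr p = norm y powr (p - 1) * norm y"
      using powr_mult_base[of "norm y" "p - 1"] by (simp add: mult.commute)
    also have "\<dots> \<le> \<delta> powr (p - 1) * norm y"
      using y p by (intro mult_right_mono powr_mono2) simp_all
    finally have small: "2 * norm y powr p \<le> \<epsilon> * norm y"
      by (simp add: \<delta>_powr)
    have "p * (norm (x + y) + norm (x - y) - 2) \<le> norm (x + y) powr p + norm (x - y) powr p - 2"
      using powr_above_tangent_at_1[of "norm (x + y)" p]
        powr_above_tangent_at_1[of "norm (x - y)" p] p
      by (simp add: algebra_simps)
    also have "\<dots> \<le> 2 * norm y powr p"
      using has_roundness_parallelogram[OF round, of x y] x by simp
    also have "\<dots> \<le> \<epsilon> * norm y" by (rule small)
    also have "\<dots> \<le> p * (\<epsilon> * norm y)"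
      using p \<epsilon> mult_right_mono[of 1 p "\<epsilon> * norm y"] by simp
    finally show ?thesis using p by simp
  qed
  moreover have "\<delta> > 0" using \<epsilon> by (simp add: \<delta>_def)
  ultimately show "\<exists>\<delta>>0. \<forall>x y :: 'a. norm x = 1 \<longrightarrow> norm y \<le> \<delta> \<longrightarrow>
      norm (x + y) + norm (x - y) \<le> 2 + \<epsilon> * norm y"
    by blast
qed

lemma nu_bound:
  fixes x y :: "'a::real_normed_vector"
  assumes "nu TYPE('a) p \<le> ereal c"
  shows "norm (x + y) powr p + norm (x - y) powr p \<le> c * (norm x powr p + norm y powr p)"
proof (cases "x = 0 \<and> y = 0")
  case True
  then show ?thesis by simp
next
  case False
  then have "norm x powr p + norm y powr p > 0"
    by (auto intro: add_pos_nonneg add_nonneg_pos)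
  moreover have "ereal ((norm (x + y) powr p + norm (x - y) powr p) /
      (norm x powr p + norm y powr p)) \<le> nu TYPE('a) p"
    unfolding nu_def using False by (intro Sup_upper) blast
  then have "(norm (x + y) powr p + norm (x - y) powr p) / (norm x powr p + norm y powr p) \<le> c"
    using assms by (metis ereal_less_eq(3) order_trans)
  ultimately show ?thesis by (simp add: pos_divide_le_eq)
qed

lemma nu_imp_uniformly_convex:
  assumes nu: "nu TYPE('a::real_normed_vector) p \<le> ereal (2 powr (p - 1))" and p: "p \<ge> 1"
  shows "uniformly_convex TYPE('a)"
  unfolding uniformly_convex_def
proof (intro allI impI)
  fix \<epsilon> :: real
  assume \<epsilon>: "\<epsilon> > 0"
  define \<delta> where "\<delta> = (\<epsilon> / 2) powr p / p"
  have "norm ((x + y) /\<^sub>R 2) \<le> 1 - \<delta>"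
    if x: "norm x = 1" and y: "norm y = 1" and xy: "\<epsilon> \<le> norm (x - y)" for x y :: 'a
  proof -
    have "norm (x + y) powr p + norm (x - y) powr p \<le> 2 powr (p - 1) * 2"
      using nu_bound[OF nu, of x y] x y by simp
    also have "\<dots> = 2 powr p" by (simp add: powr_diff)
    finally have "(norm (x + y) powr p + norm (x - y) powr p) / 2 powr p \<le> 1"
      by simp
    then have "(norm (x + y) / 2) powr p + (norm (x - y) / 2) powr p \<le> 1"
      by (simp add: powr_divide add_divide_distrib)
    moreover have "(\<epsilon> / 2) powr p \<le> (norm (x - y) / 2) powr p"
      using \<epsilon> xy p by (intro powr_mono2) simp_all
    moreover have "1 + p * (norm (x + y) / 2 - 1) \<le> (norm (x + y) / 2) powr p"
      using p by (intro powr_above_tangent_at_1) simp_all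
    ultimately have "(\<epsilon> / 2) powr p \<le> (1 - norm (x + y) / 2) * p"
      by (simp add: algebra_simps)
    then have "\<delta> \<le> 1 - norm (x + y) / 2"
      using p by (simp add: \<delta>_def pos_divide_le_eq)
    then show ?thesis by simp
  qed
  moreover have "\<delta> > 0" using \<epsilon> p by (simp add: \<delta>_def)
  ultimately show "\<exists>\<delta>>0. \<forall>x y :: 'a. norm x = 1 \<longrightarrow> norm y = 1 \<longrightarrow> \<epsilon> \<le> norm (x - y) \<longrightarrow>
      norm ((x + y) /\<^sub>R 2) \<le> 1 - \<delta>"
    by blast
qed

theorem theorem4p9:
  assumes nonzero: "\<exists>x :: 'a::banach. x \<noteq> 0"
  shows "(max_round TYPE('a) > 1 \<longrightarrow> uniformly_smooth TYPE('a)) \<and>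
         (max_coround TYPE('a) < \<infinity> \<longrightarrow> uniformly_convex TYPE('a))"
proof (intro conjI impI)
  assume "max_round TYPE('a) > 1"
  then obtain p where "p > 1" "has_roundness TYPE('a) p"
    by (auto simp: max_round_def less_Sup_iff)
  then show "uniformly_smooth TYPE('a)"
    by (intro has_roundness_imp_uniformly_smooth)
next
  assume "max_coround TYPE('a) < \<infinity>"
  then obtain p where "p \<ge> 1" "nu TYPE('a) p = ereal (2 powr (p - 1))"
    unfolding max_coround_def Inf_less_iff by blast
  then show "uniformly_convex TYPE('a)"
    by (intro nu_imp_uniformly_convex) simp_all
qed

end
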